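(* Let $(X,T)=(X_\alpha,T_\alpha)$ be an odometer with $\alpha=\langle\alpha_1,\alpha_2,\alpha_3,\ldots\rangle$, let $m_i=\alpha_1\alpha_2\cdots\alpha_i$ for $i\in\mathbb{Z}^+$, and let $\{\mathcal{P}(k)\}_{k\ge1}$, $\mathcal{P}(k)=\{T^jA(k):0\le j<m_k\}$, be a nested sequence of clopen partitions of $X$ associated with the odometer. Let $p:X\to\mathbb{Z}^+$ be a bounded function and define $S:X\to X$ by $S(x)=T^{p(x)}(x)$. Then $S$ is a bounded speedup of $T$ (that is, $S$ is a homeomorphism of $X$) and $S:X\to X$ is minimal if and only if there exists an $I\in\mathbb{Z}^+$ such that the following hold: (1) for each $j=0,1,\ldots,m_I-1$ there exists $q_j\in\mathbb{Z}^+$ such that $p(x)=q_j$ for all $x\in T^jA(I)\in\mathcal{P}(I)$; (2) the elements of $\mathcal{P}(I)$ are cyclically permuted under $S:x\mapsto T^{p(x)}(x)$; (3) $\displaystyle\sum_{j=0}^{m_I-1}q_j=c\cdot m_I$ for an integer $c$ with $\gcd(c,\alpha_k)=1$ for all $k>I$.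
   Context: Odometers: let $\alpha=\langle\alpha_1,\alpha_2,\ldots\rangle$ be a sequence of integers with every $\alpha_i\ge 2$. $X_\alpha$ is the set of sequences $(x_1,x_2,\ldots)$ with $0\le x_i\le\alpha_i-1$, with the product topology. Addition on $X_\alpha$ is coordinatewise with carrying to the right: $(x_i)+(y_i)=(z_i)$ with $r_1=0$, $z_j=(x_j+y_j+r_j)\bmod\alpha_j$, and for $j\ge2$, $r_j=0$ if $x_{j-1}+y_{j-1}+r_{j-1}<\alpha_{j-1}$ and $r_j=1$ otherwise. The odometer is $T_\alpha(x)=x+(1,0,0,\ldots)$, a minimal homeomorphism of a Cantor space. Associated partitions: with $m_k=\alpha_1\cdots\alpha_k$, these are partitions $\mathcal{P}(k)=\{T^jA(k):0\le j<m_k\}$ of $X$ into $m_k$ nonempty clopen sets that are cyclically permuted by $T$ (so $T^{m_k}A(k)=A(k)$), where $\mathcal{P}(k+1)$ refines $\mathcal{P}(k)$, the sequence $\{\mathcal{P}(k)\}$ separates points, $\bigcap_kA(k)$ is a singleton, and $T^jA(k+1)\subset T^iA(k)$ if and only if $j\equiv i\bmod m_k$. For instance one may take $A(k)=\{x\in X_\alpha:x_1=\cdots=x_k=0\}$. "Cyclically permuted" means $S$ maps elements of the partition onto elements of the partition, acting on them as a single cycle. A homeomorphism is minimal if all its orbits are dense. *)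

theory Defs
  imports "HOL-Analysis.Analysis" "HOL-Combinatorics.Orbits"
begin

(* Sequences are indexed from 1: points of the odometer are functions on {1..}, extended by
   undefined at 0, so that extensional equality is equality of sequences. *)
definition odometer_space :: "(nat \<Rightarrow> nat) \<Rightarrow> (nat \<Rightarrow> nat) topology" where
  "odometer_space \<alpha> = product_topology (\<lambda>i. discrete_topology {0..<\<alpha> i}) {1..}"

(* The incoming carry r_j, with r_1 = 0. The value at 0 is a dummy. *)
fun carry :: "(nat \<Rightarrow> nat) \<Rightarrow> (nat \<Rightarrow> nat) \<Rightarrow> (nat \<Rightarrow> nat) \<Rightarrow> nat \<Rightarrow> nat" where
  "carry \<alpha> x y 0 = 0"
| "carry \<alpha> x y (Suc 0) = 0"
| "carry \<alpha> x y (Suc (Suc j)) =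
     (if x (Suc j) + y (Suc j) + carry \<alpha> x y (Suc j) < \<alpha> (Suc j) then 0 else 1)"

definition odometer_add ::
    "(nat \<Rightarrow> nat) \<Rightarrow> (nat \<Rightarrow> nat) \<Rightarrow> (nat \<Rightarrow> nat) \<Rightarrow> (nat \<Rightarrow> nat)" where
  "odometer_add \<alpha> x y = (\<lambda>j\<in>{1..}. (x j + y j + carry \<alpha> x y j) mod \<alpha> j)"

definition odometer_map :: "(nat \<Rightarrow> nat) \<Rightarrow> (nat \<Rightarrow> nat) \<Rightarrow> (nat \<Rightarrow> nat)" where
  "odometer_map \<alpha> x = odometer_add \<alpha> x (\<lambda>j\<in>{1..}. if j = 1 then 1 else 0)"

definition odometer_period :: "(nat \<Rightarrow> nat) \<Rightarrow> nat \<Rightarrow> nat" where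
  "odometer_period \<alpha> k = (\<Prod>i=1..k. \<alpha> i)"

(* Two-sided orbit of x under a bijection S of A. *)
definition full_orbit :: "'a set \<Rightarrow> ('a \<Rightarrow> 'a) \<Rightarrow> 'a \<Rightarrow> 'a set" where
  "full_orbit A S x = {(S ^^ n) x | n. True} \<union> {(inv_into A S ^^ n) x | n. True}"

definition minimal_homeomorphism :: "'a topology \<Rightarrow> ('a \<Rightarrow> 'a) \<Rightarrow> bool" where
  "minimal_homeomorphism X S \<longleftrightarrow>
     homeomorphic_map X X S \<and>
     (\<forall>x\<in>topspace X. X closure_of (full_orbit (topspace X) S x) = topspace X)"

definition bounded_speedup :: "'a topology \<Rightarrow> ('a \<Rightarrow> 'a) \<Rightarrow> ('a \<Rightarrow> 'a) \<Rightarrow> bool" where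
  "bounded_speedup X T S \<longleftrightarrow>
     homeomorphic_map X X S \<and>
     (\<exists>p::'a \<Rightarrow> nat. (\<forall>x\<in>topspace X. p x > 0) \<and> bdd_above (p ` topspace X) \<and>
        (\<forall>x\<in>topspace X. S x = (T ^^ p x) x))"

(* cyclic_on says that P is the forward orbit of one of its own elements under the induced map
   on subsets; hence P is finite and the induced map is a single cycle on it. *)
definition cyclically_permuted :: "('a \<Rightarrow> 'a) \<Rightarrow> 'a set set \<Rightarrow> bool" where
  "cyclically_permuted S P \<longleftrightarrow> (\<forall>C\<in>P. S ` C \<in> P) \<and> cyclic_on ((`) S) P"

definition odometer_partition ::
    "(nat \<Rightarrow> nat) \<Rightarrow> (nat \<Rightarrow> (nat \<Rightarrow> nat) set) \<Rightarrow> nat \<Rightarrow> (nat \<Rightarrow> nat) set set" where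
  "odometer_partition \<alpha> A k =
     {(odometer_map \<alpha> ^^ j) ` A k | j. j < odometer_period \<alpha> k}"

(* The base sets A k are only constrained for k \<ge> 1. *)
definition associated_partitions ::
    "(nat \<Rightarrow> nat) \<Rightarrow> (nat \<Rightarrow> (nat \<Rightarrow> nat) set) \<Rightarrow> bool" where
  "associated_partitions \<alpha> A \<longleftrightarrow>
     (\<forall>k\<ge>1.
        partition_on (topspace (odometer_space \<alpha>)) (odometer_partition \<alpha> A k) \<and>
        card (odometer_partition \<alpha> A k) = odometer_period \<alpha> k \<and>
        (\<forall>C\<in>odometer_partition \<alpha> A k.
           openin (odometer_space \<alpha>) C \<and> closedin (odometer_space \<alpha>) C) \<and>
        cyclically_permuted (odometer_map \<alpha>) (odometer_partition \<alpha> A k) \<and>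
        (odometer_map \<alpha> ^^ odometer_period \<alpha> k) ` A k = A k \<and>
        refines (topspace (odometer_space \<alpha>))
          (odometer_partition \<alpha> A (Suc k)) (odometer_partition \<alpha> A k) \<and>
        (\<forall>i<odometer_period \<alpha> k. \<forall>j<odometer_period \<alpha> (Suc k).
           (odometer_map \<alpha> ^^ j) ` A (Suc k) \<subseteq> (odometer_map \<alpha> ^^ i) ` A k \<longleftrightarrow>
           j mod odometer_period \<alpha> k = i mod odometer_period \<alpha> k)) \<and>
     (\<forall>x\<in>topspace (odometer_space \<alpha>). \<forall>y\<in>topspace (odometer_space \<alpha>). x \<noteq> y \<longrightarrow>
        (\<exists>k\<ge>1. \<exists>C\<in>odometer_partition \<alpha> A k. x \<in> C \<and> y \<notin> C)) \<and>
     (\<exists>a. (\<Inter>k\<in>{1..}. A k) = {a})"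

end

theory Submission
  imports Defs "HOL-Number_Theory.Cong"
begin

text \<open>
  All that matters about the odometer is the address \<open>addr k x\<close>: the index \<open>j < m k\<close> of the
  piece \<open>T\<^sup>j A(k)\<close> that contains \<open>x\<close>. The map \<open>T\<close> adds 1 to every address modulo \<open>m k\<close>, finer
  addresses determine coarser ones, and on a compact space whose points are separated by
  addresses the pieces form a basis of clopen sets.

  Suppose that \<open>S\<close> is a minimal homeomorphism. No nonzero power of \<open>T\<close> has a fixed point, so
  \<open>p x = i\<close> holds exactly where \<open>S x = T\<^sup>i x\<close>, which is a closed condition because \<open>S\<close> is
  continuous. As \<open>p\<close> is bounded, finitely many disjoint closed level sets cover the space; hence
  they are open, and by compactness \<open>p x\<close> is a function \<open>q\<close> of the address at one level \<open>I\<close>. From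
  level \<open>I\<close> on, \<open>S\<close> acts on the addresses of level \<open>k\<close>, and a proper cycle of this action would
  give a proper clopen invariant set; so minimality makes the action cyclic
  (\<open>minimal_imp_cyclic\<close>).

  Once \<open>S\<close> is cyclic at level \<open>I\<close>, a point returns to its piece after \<open>m I\<close> steps, having visited
  every piece once. Its return map is therefore the single power \<open>T\<^sup>N\<close> with \<open>N\<close> the sum of the
  \<open>q j\<close> (\<open>return_map\<close>), and \<open>N = c * m I\<close> because the return preserves the address at level \<open>I\<close>.
  At level \<open>k\<close> the piece splits into \<open>m k div m I\<close> smaller ones, and the return map rotates
  these by \<open>c\<close>. This rotation is transitive iff \<open>c\<close> is coprime to \<open>m k div m I\<close>, the product of
  the entries of \<open>\<alpha>\<close> between \<open>I\<close> and \<open>k\<close> (\<open>cyclic_imp_coprime\<close>, \<open>coprime_imp_orbit_meets_fibre\<close>).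

  Conversely, coprimality at all levels makes every forward orbit meet every piece, so all orbits
  are dense. The image of \<open>S\<close> is compact and contains such orbits, so \<open>S\<close> is onto; and it is
  one-to-one because it permutes the addresses of level \<open>I\<close> and is a power of \<open>T\<close> on each piece
  (\<open>coprime_imp_minimal\<close>).
\<close>

section \<open>Cyclic maps on finite sets\<close>

lemma cyclic_on_bij_betw_funpow:
  assumes "cyclic_on f D" and "a \<in> D"
  shows "bij_betw (\<lambda>n. (f ^^ n) a) {..<card D} D" and "(f ^^ card D) a = a"
proof -
  have D: "orbit f a = D"
    using assms by (rule orbit_cyclic_eq3)
  hence a: "a \<in> orbit f a"
    using assms by simp
  let ?d = "funpow_dist1 f a a"
  have bij: "bij_betw (\<lambda>n. (f ^^ n) a) {0..<?d} D"
    unfolding bij_betw_def using inj_on_funpow_dist1[OF a] orbit_conv_funpow_dist1[OF a] D by simp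
  have card: "card D = ?d"
    using bij_betw_same_card[OF bij] by simp
  show "bij_betw (\<lambda>n. (f ^^ n) a) {..<card D} D"
    unfolding card using bij by (simp only: atLeast0LessThan)
  show "(f ^^ card D) a = a"
    unfolding card using a by (rule funpow_dist1_prop)
qed

lemma cyclic_on_funpow_fixed_imp_dvd:
  assumes "cyclic_on f D" and "a \<in> D" and "(f ^^ n) a = a"
  shows "card D dvd n"
proof -
  note bij = cyclic_on_bij_betw_funpow[OF assms(1,2)]
  have pos: "card D > 0"
    using finite_cyclic_on[OF assms(1)] assms(2) card_gt_0_iff by blast
  have "(f ^^ (n mod card D)) a = (f ^^ 0) a"
    using funpow_mod_eq[OF bij(2), of n] assms(3) by simp
  hence "n mod card D = 0"
    using bij(1) pos unfolding bij_betw_def inj_on_def by (metis lessThan_iff mod_less_divisor)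
  thus ?thesis by auto
qed

lemma cyclic_on_reaches:
  assumes "cyclic_on f D" and "a \<in> D" and "b \<in> D"
  shows "\<exists>n. (f ^^ n) a = b"
proof -
  have "b \<in> orbit f a" using orbit_cyclic_eq3[OF assms(1,2)] assms(3) by simp
  thus ?thesis unfolding orbit_altdef by blast
qed

lemma cyclic_on_inj_on:
  assumes "cyclic_on f D"
  shows "inj_on f D"
proof -
  have "f ` D = D"
  proof (intro equalityI subsetI)
    fix b assume b: "b \<in> D"
    have "b \<in> orbit f b" using orbit_cyclic_eq3[OF assms b] b by simp
    thus "b \<in> f ` D"
      using orbit_cyclic_eq3[OF assms b] b by cases auto
  qed (use cyclic_on_inI[OF assms] in auto)
  thus ?thesis
    using finite_cyclic_on[OF assms] by (simp add: eq_card_imp_inj_on)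
qed

lemma cyclic_on_image_iff:
  assumes "inj_on h D" and "f ` D \<subseteq> D" and "\<And>x. x \<in> D \<Longrightarrow> g (h x) = h (f x)"
  shows "cyclic_on g (h ` D) \<longleftrightarrow> cyclic_on f D"
proof
  assume "cyclic_on g (h ` D)"
  hence "cyclic_on f (inv_into D h ` (h ` D))"
    by (rule cyclic_on_image) (use assms in \<open>auto simp: inv_into_f_f\<close>)
  thus "cyclic_on f D"
    using assms(1) by (simp add: image_comp inv_into_f_f cong: image_cong)
next
  assume "cyclic_on f D"
  thus "cyclic_on g (h ` D)" by (rule cyclic_on_image) (use assms in auto)
qed

section \<open>Addresses in a cyclic tower\<close>

text \<open>
  The data of a nested sequence of clopen partitions, each cyclically permuted by \<open>T\<close>, recorded
  through the index \<open>addr k x\<close> of the member of the \<open>k\<close>-th partition that contains \<open>x\<close>. This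
  turns statements about images of sets under powers of \<open>T\<close> into arithmetic modulo \<open>m k\<close>.
  Levels start at 1.
\<close>

locale cyclic_tower =
  fixes X :: "'a topology" and T :: "'a \<Rightarrow> 'a" and m :: "nat \<Rightarrow> nat" and addr :: "nat \<Rightarrow> 'a \<Rightarrow> nat"
  assumes compact: "compact_space X"
    and nonempty: "topspace X \<noteq> {}"
    and T_in: "x \<in> topspace X \<Longrightarrow> T x \<in> topspace X"
    and period_dvd: "1 \<le> k \<Longrightarrow> m k dvd m (Suc k)"
    and period_less: "1 \<le> k \<Longrightarrow> m k < m (Suc k)"
    and addr_less: "1 \<le> k \<Longrightarrow> x \<in> topspace X \<Longrightarrow> addr k x < m k"
    and addr_T: "1 \<le> k \<Longrightarrow> x \<in> topspace X \<Longrightarrow> addr k (T x) = Suc (addr k x) mod m k"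
    and addr_Suc: "1 \<le> k \<Longrightarrow> x \<in> topspace X \<Longrightarrow> addr (Suc k) x mod m k = addr k x"
    and open_fibre: "1 \<le> k \<Longrightarrow> openin X {x \<in> topspace X. addr k x = j}"
    and addr_eqI: "x \<in> topspace X \<Longrightarrow> y \<in> topspace X \<Longrightarrow> (\<And>k. 1 \<le> k \<Longrightarrow> addr k x = addr k y) \<Longrightarrow> x = y"
begin

lemma period_pos: "1 \<le> k \<Longrightarrow> 0 < m k"
  using nonempty addr_less by fastforce

lemma period_dvd_le:
  assumes "1 \<le> k" "k \<le> l"
  shows "m k dvd m l"
  using assms(2)
proof (induction l rule: dec_induct)
  case (step l)
  thus ?case using assms(1) period_dvd[of l] by (auto intro: dvd_trans)
qed simp

lemma period_ge: "1 \<le> k \<Longrightarrow> k \<le> m k"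
proof (induction k rule: dec_induct)
  case base show ?case using period_pos[of 1] by simp
next
  case (step k) thus ?case using period_less[of k] by simp
qed

lemma addr_mod:
  assumes "1 \<le> k" "k \<le> l" "x \<in> topspace X"
  shows "addr l x mod m k = addr k x"
  using assms(2)
proof (induction l rule: dec_induct)
  case base thus ?case using addr_less[of k x] assms by simp
next
  case (step l)
  hence "addr k x = (addr (Suc l) x mod m l) mod m k"
    using addr_Suc[of l x] assms by simp
  also have "\<dots> = addr (Suc l) x mod m k"
    using period_dvd_le[of k l] step assms by (simp add: mod_mod_cancel)
  finally show ?case by simp
qed

lemma addr_eq_lower:
  "1 \<le> k \<Longrightarrow> k \<le> l \<Longrightarrow> x \<in> topspace X \<Longrightarrow> y \<in> topspace X \<Longrightarrow> addr l x = addr l y \<Longrightarrow> addr k x = addr k y"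
  using addr_mod by metis

lemma funpow_T_in: "x \<in> topspace X \<Longrightarrow> (T ^^ n) x \<in> topspace X"
  by (induction n) (auto intro: T_in)

lemma addr_funpow_T:
  assumes "1 \<le> k" "x \<in> topspace X"
  shows "addr k ((T ^^ n) x) = (addr k x + n) mod m k"
proof (induction n)
  case 0 thus ?case using addr_less assms by simp
next
  case (Suc n)
  have "addr k ((T ^^ Suc n) x) = Suc ((addr k x + n) mod m k) mod m k"
    using addr_T[OF assms(1) funpow_T_in[OF assms(2), of n]] Suc by simp
  thus ?case by (simp add: mod_Suc_eq)
qed

lemma addr_surj:
  assumes "1 \<le> k" "j < m k"
  shows "\<exists>x\<in>topspace X. addr k x = j"
proof -
  obtain x where x: "x \<in> topspace X" using nonempty by blast
  have lt: "addr k x < m k" using addr_less assms x by blast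
  have "addr k ((T ^^ (m k - addr k x + j)) x) = (m k + j) mod m k"
    using addr_funpow_T[OF assms(1) x] lt by simp
  hence "addr k ((T ^^ (m k - addr k x + j)) x) = j"
    using assms by simp
  thus ?thesis using funpow_T_in x by blast
qed

lemma addr_funpow_T_cancel:
  assumes "1 \<le> k" "x \<in> topspace X" "y \<in> topspace X" "addr k ((T ^^ n) x) = addr k ((T ^^ n) y)"
  shows "addr k x = addr k y"
proof -
  have "[addr k x + n = addr k y + n] (mod m k)"
    using assms addr_funpow_T by (simp add: cong_def)
  hence "[addr k x = addr k y] (mod m k)"
    by (simp add: cong_add_rcancel_nat)
  thus ?thesis
    using assms addr_less by (simp add: cong_def)
qed

lemma funpow_T_inject:
  assumes "x \<in> topspace X" "y \<in> topspace X" "(T ^^ n) x = (T ^^ n) y"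
  shows "x = y"
proof (rule addr_eqI[OF assms(1,2)])
  fix k :: nat assume "1 \<le> k"
  thus "addr k x = addr k y"
    using assms(3) by (intro addr_funpow_T_cancel[OF _ assms(1,2), of k n]) simp_all
qed

text \<open>
  The exponents agree modulo every period, and the periods are unbounded.
\<close>

lemma funpow_T_exponent_eq:
  assumes x: "x \<in> topspace X" and eq: "(T ^^ n) x = (T ^^ n') x"
  shows "n = n'"
proof -
  let ?k = "Suc (n + n')"
  have "[addr ?k x + n = addr ?k x + n'] (mod m ?k)"
    using addr_funpow_T[of ?k x n] addr_funpow_T[of ?k x n'] x eq by (simp add: cong_def)
  hence "[n = n'] (mod m ?k)"
    by (simp add: cong_add_lcancel_nat)
  moreover have "n < m ?k" "n' < m ?k"
    using period_ge[of ?k] by linarith+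
  ultimately show ?thesis
    using cong_less_modulus_unique_nat by blast
qed

lemma open_addr_set:
  assumes "1 \<le> k"
  shows "openin X {x \<in> topspace X. addr k x \<in> J}"
proof -
  have "{x \<in> topspace X. addr k x \<in> J} = (\<Union>j\<in>J. {x \<in> topspace X. addr k x = j})" by auto
  thus ?thesis using open_fibre[OF assms] by auto
qed

lemma closed_addr_set:
  assumes "1 \<le> k"
  shows "closedin X {x \<in> topspace X. addr k x \<in> J}"
proof -
  have "topspace X - {x \<in> topspace X. addr k x \<in> J} = {x \<in> topspace X. addr k x \<in> - J}" by auto
  thus ?thesis using open_addr_set[OF assms, of "- J"] by (auto simp: closedin_def)
qed

text \<open>
  The fibres form a basis: the parts of the nested fibres of \<open>x\<close> that lie outside \<open>U\<close> are closed
  and decreasing, and a common point would have the same addresses as \<open>x\<close>, hence be \<open>x\<close>. The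
  bound \<open>K\<close> is there because the dynamics of a speedup is visible only at sufficiently fine levels.
\<close>

lemma fibre_in_open:
  assumes U: "openin X U" and x: "x \<in> U"
  shows "\<exists>k\<ge>K. 1 \<le> k \<and> {y \<in> topspace X. addr k y = addr k x} \<subseteq> U"
proof (rule ccontr)
  assume contr: "\<not> ?thesis"
  define C where "C n = {y \<in> topspace X. addr (K + Suc n) y \<in> {addr (K + Suc n) x}} - U" for n
  have xX: "x \<in> topspace X" using U x openin_subset by blast
  have "closedin X (C n)" for n
    unfolding C_def by (intro closedin_diff closed_addr_set U) simp
  moreover have "C n \<noteq> {}" for n
  proof -
    have "\<not> {y \<in> topspace X. addr k y = addr k x} \<subseteq> U" if "K \<le> k" "1 \<le> k" for k
      using contr that by blast
    from this[of "K + Suc n"] show ?thesis unfolding C_def by auto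
  qed
  moreover have "decseq C"
    unfolding decseq_Suc_iff
  proof (intro allI subsetI)
    fix n y assume "y \<in> C (Suc n)"
    thus "y \<in> C n"
      unfolding C_def using addr_eq_lower[of "K + Suc n" "K + Suc (Suc n)" y x] xX by auto
  qed
  ultimately obtain y where y: "y \<in> (\<Inter>n. C n)"
    using compact_space_imp_nest[OF compact] by blast
  hence yX: "y \<in> topspace X" and yU: "y \<notin> U"
    unfolding C_def by auto
  have "y = x"
  proof (rule addr_eqI[OF yX xX])
    fix k :: nat assume "1 \<le> k"
    moreover have "addr (K + Suc k) y = addr (K + Suc k) x" using y unfolding C_def by auto
    ultimately show "addr k y = addr k x"
      using addr_eq_lower[of k "K + Suc k" y x] yX xX by simp
  qed
  thus False using yU x by simp
qed

lemma Hausdorff: "Hausdorff_space X"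
  unfolding Hausdorff_space_def
proof (intro allI impI, elim conjE)
  fix x y assume xy: "x \<in> topspace X" "y \<in> topspace X" "x \<noteq> y"
  then obtain k where k: "1 \<le> k" "addr k x \<noteq> addr k y"
    using addr_eqI by blast
  show "\<exists>U V. openin X U \<and> openin X V \<and> x \<in> U \<and> y \<in> V \<and> disjnt U V"
    using open_fibre[OF k(1), of "addr k x"] open_fibre[OF k(1), of "addr k y"] xy k
    by (intro exI[of _ "{z \<in> topspace X. addr k z = addr k x}"]
        exI[of _ "{z \<in> topspace X. addr k z = addr k y}"]) (auto simp: disjnt_def)
qed

text \<open>
  A map that induces a map of addresses at all fine levels pulls basic fibres back to unions of
  fibres. This covers both the powers of \<open>T\<close> and their speedups.
\<close>

lemma continuous_if_addr_determined:
  assumes F: "\<And>x. x \<in> topspace X \<Longrightarrow> F x \<in> topspace X"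
    and det: "\<And>k x y. K \<le> k \<Longrightarrow> 1 \<le> k \<Longrightarrow> x \<in> topspace X \<Longrightarrow> y \<in> topspace X \<Longrightarrow>
      addr k x = addr k y \<Longrightarrow> addr k (F x) = addr k (F y)"
  shows "continuous_map X X F"
  unfolding continuous_map_def
proof (intro conjI allI impI)
  show "F \<in> topspace X \<rightarrow> topspace X" using F by blast
  fix U assume U: "openin X U"
  show "openin X {x \<in> topspace X. F x \<in> U}"
  proof (subst openin_subopen, intro ballI)
    fix x assume "x \<in> {x \<in> topspace X. F x \<in> U}"
    hence x: "x \<in> topspace X" "F x \<in> U" by auto
    obtain k where k: "k \<ge> K" "1 \<le> k" "{y \<in> topspace X. addr k y = addr k (F x)} \<subseteq> U"
      using fibre_in_open[OF U x(2)] by blast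
    show "\<exists>V. openin X V \<and> x \<in> V \<and> V \<subseteq> {x \<in> topspace X. F x \<in> U}"
    proof (intro exI conjI)
      show "openin X {y \<in> topspace X. addr k y = addr k x}" by (rule open_fibre[OF k(2)])
      show "{y \<in> topspace X. addr k y = addr k x} \<subseteq> {x \<in> topspace X. F x \<in> U}"
        using k(3) det[OF k(1,2) _ x(1)] F by blast
    qed (use x in simp)
  qed
qed

lemma continuous_funpow_T: "continuous_map X X (T ^^ n)"
  by (rule continuous_if_addr_determined) (auto simp: addr_funpow_T funpow_T_in)

text \<open>
  Every point has a fibre on which \<open>f\<close> is constant. Finitely many of these fibres cover the space,
  and the finest level among them works everywhere.
\<close>

lemma locally_constant_imp_addr_determined:
  assumes open_level: "\<And>v. openin X {x \<in> topspace X. f x = v}"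
  shows "\<exists>I\<ge>1. \<forall>x\<in>topspace X. \<forall>y\<in>topspace X. addr I x = addr I y \<longrightarrow> f x = f y"
proof -
  have "\<exists>k\<ge>1. {y \<in> topspace X. addr k y = addr k x} \<subseteq> {y \<in> topspace X. f y = f x}"
    if "x \<in> topspace X" for x
    using fibre_in_open[OF open_level[of "f x"], of x] that by auto
  then obtain k where k: "\<And>x. x \<in> topspace X \<Longrightarrow> k x \<ge> (1::nat)"
    "\<And>x y. x \<in> topspace X \<Longrightarrow> y \<in> topspace X \<Longrightarrow> addr (k x) y = addr (k x) x \<Longrightarrow> f y = f x"
    by (auto simp: subset_iff) metis
  define V where "V x = {y \<in> topspace X. addr (k x) y = addr (k x) x}" for x
  have "\<forall>U\<in>V ` topspace X. openin X U"
    using open_fibre k(1) by (auto simp: V_def)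
  moreover have "topspace X \<subseteq> \<Union>(V ` topspace X)"
    by (auto simp: V_def)
  ultimately obtain \<F> where "finite \<F>" "\<F> \<subseteq> V ` topspace X" "topspace X \<subseteq> \<Union>\<F>"
    using compact unfolding compact_space_alt by meson
  then obtain F where F: "finite F" "F \<subseteq> topspace X" "topspace X \<subseteq> (\<Union>x\<in>F. V x)"
    by (metis finite_subset_image)
  define I where "I = Max (insert 1 (k ` F))"
  have I: "1 \<le> I" "\<And>z. z \<in> F \<Longrightarrow> k z \<le> I"
    using F(1) unfolding I_def by auto
  have "f x = f y" if xy: "x \<in> topspace X" "y \<in> topspace X" "addr I x = addr I y" for x y
  proof -
    obtain z where z: "z \<in> F" "addr (k z) x = addr (k z) z"
      using F(3) xy(1) unfolding V_def by blast
    have zX: "z \<in> topspace X" using z F by blast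
    have "addr (k z) x = addr (k z) y"
      using addr_eq_lower[OF k(1)[OF zX] I(2)[OF z(1)]] xy by blast
    thus ?thesis using k(2)[OF zX] z xy by metis
  qed
  thus ?thesis using I(1) by blast
qed

end

section \<open>Speedups of a cyclic tower\<close>

text \<open>
  The effect on addresses modulo \<open>M\<close> of moving each point at address \<open>j\<close> by \<open>q j\<close> steps.
\<close>

definition displace :: "nat \<Rightarrow> (nat \<Rightarrow> nat) \<Rightarrow> nat \<Rightarrow> nat" where
  "displace M q j = (j + q j) mod M"

locale tower_speedup = cyclic_tower X T m addr
  for X :: "'a topology" and T m addr +
  fixes p :: "'a \<Rightarrow> nat" and S :: "'a \<Rightarrow> 'a"
  assumes S_def: "S = (\<lambda>x. (T ^^ p x) x)"
begin

lemma S_in: "x \<in> topspace X \<Longrightarrow> S x \<in> topspace X"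
  by (simp add: S_def funpow_T_in)

lemma funpow_S_in: "x \<in> topspace X \<Longrightarrow> (S ^^ n) x \<in> topspace X"
  by (induction n) (auto intro: S_in)

lemma funpow_S: "(S ^^ n) x = (T ^^ (\<Sum>i<n. p ((S ^^ i) x))) x"
proof (induction n)
  case (Suc n)
  have "(S ^^ Suc n) x = (T ^^ p ((S ^^ n) x)) ((S ^^ n) x)" by (simp add: S_def)
  also have "\<dots> = (T ^^ p ((S ^^ n) x)) ((T ^^ (\<Sum>i<n. p ((S ^^ i) x))) x)"
    using Suc by simp
  also have "\<dots> = (T ^^ (\<Sum>i<Suc n. p ((S ^^ i) x))) x"
    by (simp add: funpow_add add.commute)
  finally show ?case .
qed simp

text \<open>
  The level set of \<open>i\<close> is the set where \<open>S\<close> coincides with \<open>T\<^sup>i\<close>, which is closed. Its complement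
  is a union of finitely many such sets, because \<open>p\<close> is bounded.
\<close>

lemma continuous_speedup_imp_open_levels:
  assumes S: "continuous_map X X S" and bdd: "bdd_above (p ` topspace X)"
  shows "openin X {x \<in> topspace X. p x = v}"
proof -
  obtain B where B: "\<And>x. x \<in> topspace X \<Longrightarrow> p x \<le> B"
    using bdd by (auto simp: bdd_above_def)
  have level: "{x \<in> topspace X. S x = (T ^^ i) x} = {x \<in> topspace X. p x = i}" for i
    using funpow_T_exponent_eq by (auto simp: S_def)
  have "closedin X {x \<in> topspace X. p x = i}" for i
    using closedin_continuous_maps_eq[OF Hausdorff S continuous_funpow_T[of i]] level by simp
  hence "closedin X (\<Union>i\<in>{..B} - {v}. {x \<in> topspace X. p x = i})"
    by (intro closedin_Union) auto
  moreover have "{x \<in> topspace X. p x = v} =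
      topspace X - (\<Union>i\<in>{..B} - {v}. {x \<in> topspace X. p x = i})"
    using B by auto
  ultimately show ?thesis by auto
qed

end

text \<open>
  Speedups whose exponent depends only on the address at level \<open>I\<close>; these act on the addresses
  of every level \<open>k \<ge> I\<close>, by the map called \<open>move k\<close> below.
\<close>

locale level_speedup = tower_speedup X T m addr p S
  for X :: "'a topology" and T m addr p S +
  fixes I :: nat and q :: "nat \<Rightarrow> nat"
  assumes I_pos: "1 \<le> I"
    and p_eq: "x \<in> topspace X \<Longrightarrow> p x = q (addr I x)"
begin

abbreviation move :: "nat \<Rightarrow> nat \<Rightarrow> nat" where
  "move k \<equiv> displace (m k) (\<lambda>j. q (j mod m I))"

lemma move_cong_base: "j < m I \<Longrightarrow> move I j = displace (m I) q j"
  by (simp add: displace_def)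

lemma addr_S:
  assumes "I \<le> k" "x \<in> topspace X"
  shows "addr k (S x) = move k (addr k x)"
proof -
  have "p x = q (addr k x mod m I)"
    unfolding addr_mod[OF I_pos assms] using assms(2) by (rule p_eq)
  moreover have "addr k (S x) = (addr k x + p x) mod m k"
    unfolding S_def using assms I_pos by (intro addr_funpow_T) simp_all
  ultimately show ?thesis by (simp add: displace_def)
qed

lemma addr_funpow_S:
  assumes "I \<le> k" "x \<in> topspace X"
  shows "addr k ((S ^^ n) x) = (move k ^^ n) (addr k x)"
proof (induction n)
  case (Suc n)
  thus ?case using addr_S[OF assms(1) funpow_S_in[OF assms(2), of n]] by simp
qed simp

lemma continuous_S: "continuous_map X X S"
  by (rule continuous_if_addr_determined[where K = I]) (auto simp: addr_S S_in)

text \<open>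
  The addresses on the cycle of one point form a set invariant under \<open>move k\<close> and its inverse, so
  the points with such addresses form a closed set containing a full orbit. Density of that orbit
  forces the cycle to contain all addresses.
\<close>

lemma minimal_imp_cyclic:
  assumes S: "minimal_homeomorphism X S" and k: "I \<le> k"
  shows "cyclic_on (move k) {..<m k}"
proof -
  let ?D = "{..<m k}"
  have k1: "1 \<le> k" using k I_pos by simp
  have hom: "homeomorphic_map X X S" using S by (simp add: minimal_homeomorphism_def)
  have surj: "S ` topspace X = topspace X" using homeomorphic_imp_surjective_map[OF hom] .
  have img: "move k ` ?D = ?D"
  proof (intro equalityI subsetI)
    fix j assume "j \<in> ?D"
    then obtain y where y: "y \<in> topspace X" "addr k y = j" using addr_surj[OF k1] by auto
    then obtain x where x: "x \<in> topspace X" "S x = y" using surj by (metis imageE)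
    have "j = move k (addr k x)" using addr_S[OF k x(1)] x y by simp
    thus "j \<in> move k ` ?D" using addr_less[OF k1 x(1)] by auto
  qed (use period_pos[OF k1] in \<open>auto simp: displace_def\<close>)
  hence bij: "bij_betw (move k) ?D ?D"
    unfolding bij_betw_def by (simp add: eq_card_imp_inj_on)
  \<comment> \<open>Extended by the identity outside the addresses, \<open>move k\<close> becomes a permutation of all naturals.\<close>
  define \<sigma> where "\<sigma> = perm_restrict (move k) ?D"
  have perm: "\<sigma> permutes ?D"
  proof (rule bij_imp_permutes)
    show "bij_betw \<sigma> ?D ?D"
      using bij bij_betw_cong[of ?D \<sigma> "move k" ?D] by (simp add: \<sigma>_def perm_restrict_simps)
  qed (simp add: \<sigma>_def perm_restrict_simps)
  obtain x where x: "x \<in> topspace X" using nonempty by blast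
  define Orb where "Orb = orbit \<sigma> (addr k x)"
  have cyc: "cyclic_on \<sigma> Orb"
    unfolding Orb_def by (rule cyclic_on_orbit[OF perm]) simp
  have xO: "addr k x \<in> Orb"
    unfolding Orb_def using perm by (intro permutation_self_in_orbit) (auto simp: permutation_permutes)
  have OD: "Orb \<subseteq> ?D"
    unfolding Orb_def using addr_less[OF k1 x] by (intro permutes_orbit_subset[OF perm]) auto
  have step: "addr k (S y) = \<sigma> (addr k y)" if "y \<in> topspace X" for y
    using that addr_S[OF k that] addr_less[OF k1 that] by (simp add: \<sigma>_def perm_restrict_simps)
  let ?inv = "inv_into (topspace X) S"
  have fwd: "(S ^^ n) x \<in> topspace X \<and> addr k ((S ^^ n) x) \<in> Orb" for n
    by (induction n) (auto simp: x xO S_in step intro: cyclic_on_inI[OF cyc])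
  have bwd: "(?inv ^^ n) x \<in> topspace X \<and> addr k ((?inv ^^ n) x) \<in> Orb" for n
  proof (induction n)
    case (Suc n)
    let ?y = "(?inv ^^ n) x"
    have y: "?inv ?y \<in> topspace X" "S (?inv ?y) = ?y"
      using Suc surj by (auto intro: inv_into_into f_inv_into_f)
    hence "\<sigma> (addr k (?inv ?y)) \<in> Orb" using step[OF y(1)] Suc by simp
    thus ?case using cyclic_on_f_in[OF perm cyc] y by simp
  qed (simp add: x xO)
  have "full_orbit (topspace X) S x \<subseteq> {y \<in> topspace X. addr k y \<in> Orb}"
    using fwd bwd unfolding full_orbit_def by blast
  hence "X closure_of full_orbit (topspace X) S x \<subseteq> {y \<in> topspace X. addr k y \<in> Orb}"
    by (intro closure_of_minimal closed_addr_set k1)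
  hence "topspace X \<subseteq> {y \<in> topspace X. addr k y \<in> Orb}"
    using S x unfolding minimal_homeomorphism_def by simp
  hence "?D \<subseteq> Orb" using addr_surj[OF k1] by auto
  hence "Orb = ?D" using OD by blast
  thus ?thesis using cyc unfolding \<sigma>_def by (simp add: cyclic_on_perm_restrict)
qed

end

locale cyclic_speedup = level_speedup +
  assumes cyclic: "cyclic_on (displace (m I) q) {..<m I}"
begin

lemma cyclic_move: "cyclic_on (move I) {..<m I}"
  using cyclic cyclic_cong[of "{..<m I}" "move I" "displace (m I) q"] move_cong_base by simp

text \<open>
  During the first \<open>m I\<close> steps the address at level \<open>I\<close> takes every value exactly once, so the
  total displacement is the same for all points.
\<close>

lemma return_map:
  assumes x: "x \<in> topspace X"
  shows "(S ^^ m I) x = (T ^^ (\<Sum>j<m I. q j)) x"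
proof -
  have a: "addr I x \<in> {..<m I}" using addr_less I_pos x by simp
  have "(\<Sum>i<m I. p ((S ^^ i) x)) = (\<Sum>i<m I. q ((move I ^^ i) (addr I x)))"
    using x by (simp add: p_eq funpow_S_in addr_funpow_S)
  also have "\<dots> = (\<Sum>j<m I. q j)"
    using sum.reindex_bij_betw[OF cyclic_on_bij_betw_funpow(1)[OF cyclic_move a], of q] by simp
  finally show ?thesis using funpow_S[of "m I" x] by (simp only:)
qed

text \<open>
  The return map preserves the address at level \<open>I\<close>, whereas \<open>T\<close> to the power \<open>N\<close> adds \<open>N\<close> to it.
\<close>

lemma period_dvd_sum: "m I dvd (\<Sum>j<m I. q j)"
proof -
  obtain x where x: "x \<in> topspace X" using nonempty by blast
  have a: "addr I x \<in> {..<m I}" using addr_less I_pos x by simp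
  have "addr I ((T ^^ (\<Sum>j<m I. q j)) x) = addr I x"
    using return_map[OF x] addr_funpow_S[OF order_refl x, of "m I"]
      cyclic_on_bij_betw_funpow(2)[OF cyclic_move a] by simp
  hence "[addr I x + (\<Sum>j<m I. q j) = addr I x + 0] (mod m I)"
    using addr_funpow_T[OF I_pos x] addr_less[OF I_pos x] by (simp add: cong_def)
  thus ?thesis by (simp only: cong_add_lcancel_nat cong_0_iff)
qed

lemma addr_iterated_return:
  assumes k: "I \<le> k" and x: "x \<in> topspace X" and sum: "(\<Sum>j<m I. q j) = c * m I"
  shows "addr k ((S ^^ (m I * t)) x) = (addr k x + c * m I * t) mod m k"
proof -
  have "(S ^^ (m I * t)) x = (T ^^ (c * m I * t)) x"
  proof (induction t)
    case (Suc t)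
    have "(S ^^ (m I * Suc t)) x = (S ^^ m I) ((S ^^ (m I * t)) x)"
      by (simp only: mult_Suc_right funpow_add o_apply)
    also have "\<dots> = (T ^^ (c * m I)) ((T ^^ (c * m I * t)) x)"
      using return_map[OF funpow_S_in[OF x], of "m I * t"] unfolding sum Suc .
    finally show ?case by (simp only: mult_Suc_right funpow_add o_apply)
  qed simp
  thus ?thesis using addr_funpow_T[of k x] k I_pos x by simp
qed

text \<open>
  Inside one piece of level \<open>I\<close>, neighbouring pieces of level \<open>k\<close> are \<open>m I\<close> apart and the return map
  moves by \<open>c * m I\<close>. Going from a piece to its neighbour takes a whole number \<open>t\<close> of
  returns, and then \<open>c * t\<close> is 1 modulo \<open>m k div m I\<close>.
\<close>

lemma cyclic_imp_coprime:
  assumes k: "I \<le> k" and sum: "(\<Sum>j<m I. q j) = c * m I" and cyc: "cyclic_on (move k) {..<m k}"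
  shows "coprime c (m k div m I)"
proof -
  have k1: "1 \<le> k" using k I_pos by simp
  obtain r where r: "m k = m I * r" using period_dvd_le[OF I_pos k] by (elim dvdE)
  have mI: "m I > 0" using period_pos I_pos by simp
  obtain x where x: "x \<in> topspace X" using nonempty by blast
  let ?b = "(addr k x + m I) mod m k"
  obtain n where n: "(move k ^^ n) (addr k x) = ?b"
    using cyclic_on_reaches[OF cyc, of "addr k x" ?b] addr_less[OF k1 x] period_pos[OF k1] by auto
  hence hit: "addr k ((S ^^ n) x) = ?b" using addr_funpow_S[OF k x] by simp
  \<comment> \<open>The target lies in the same piece of level \<open>I\<close>, so \<open>n\<close> is a whole number of returns.\<close>
  have "addr I ((S ^^ n) x) = ?b mod m I"
    using addr_mod[OF I_pos k funpow_S_in[OF x]] hit by metis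
  also have "\<dots> = addr k x mod m I" by (simp add: r mod_mult2_eq)
  also have "\<dots> = addr I x" using addr_mod[OF I_pos k x] .
  finally have "(move I ^^ n) (addr I x) = addr I x" using addr_funpow_S[OF order_refl x] by simp
  hence "card {..<m I} dvd n"
    using cyclic_on_funpow_fixed_imp_dvd[OF cyclic_move] addr_less[OF I_pos x] by simp
  then obtain t where t: "n = m I * t" by auto
  have "[addr k x + c * m I * t = addr k x + m I] (mod m k)"
    using addr_iterated_return[OF k x sum, of t] hit t by (simp add: cong_def)
  hence "[c * m I * t = m I] (mod m k)" by (simp add: cong_add_lcancel_nat)
  hence "[m I * (c * t) = m I * 1] (mod m I * r)" by (simp add: r ac_simps)
  hence "[c * t = 1] (mod r)"
    using mI by (simp add: cong_def flip: mult_mod_right)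
  hence "coprime c r" unfolding coprime_iff_invertible_nat by auto
  thus ?thesis using r mI by simp
qed

text \<open>
  Cyclicity at level \<open>I\<close> brings the orbit into the piece of level \<open>I\<close> around the target. The
  remaining distance is a multiple of \<open>m I\<close>, and repeated returns cover it because \<open>c\<close> is
  invertible modulo \<open>m k div m I\<close>.
\<close>

lemma coprime_imp_orbit_meets_fibre:
  assumes k: "I \<le> k" and sum: "(\<Sum>j<m I. q j) = c * m I" and cop: "coprime c (m k div m I)"
    and x: "x \<in> topspace X" and j: "j < m k"
  shows "\<exists>n. addr k ((S ^^ n) x) = j"
proof -
  have k1: "1 \<le> k" using k I_pos by simp
  obtain r where r: "m k = m I * r" using period_dvd_le[OF I_pos k] by (elim dvdE)
  have mI: "m I > 0" using period_pos I_pos by simp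
  have "addr I x \<in> {..<m I}" "j mod m I \<in> {..<m I}" using addr_less[OF I_pos x] mI by auto
  from cyclic_on_reaches[OF cyclic_move this] obtain n where "(move I ^^ n) (addr I x) = j mod m I" ..
  hence n: "addr I ((S ^^ n) x) = j mod m I" using addr_funpow_S[OF order_refl x] by simp
  define y where "y = (S ^^ n) x"
  have y: "y \<in> topspace X" unfolding y_def by (rule funpow_S_in[OF x])
  let ?a = "addr k y"
  have a: "?a mod m I = j mod m I" using addr_mod[OF I_pos k y] n y_def by simp
  have alt: "?a < m k" using addr_less[OF k1 y] .
  \<comment> \<open>Adding \<open>m k\<close> to the target keeps the distance a natural number.\<close>
  have "(j + m k) mod m I = ?a mod m I" using a by (simp add: r)
  hence "m I dvd (j + m k) - ?a" using alt by (simp add: mod_eq_dvd_iff_nat)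
  then obtain d where d: "j + m k - ?a = m I * d" by (elim dvdE)
  have "coprime c r" using cop r mI by simp
  then obtain s where "[c * s = 1] (mod r)" unfolding coprime_iff_invertible_nat by auto
  hence "[c * s * d = 1 * d] (mod r)" by (rule cong_scalar_right)
  hence "[m I * (c * s * d) = m I * d] (mod m I * r)"
    by (simp add: cong_def flip: mult_mod_right)
  hence "[?a + m I * (c * s * d) = ?a + m I * d] (mod m k)" by (simp add: r cong_add_lcancel_nat)
  moreover have "?a + m I * d = j + m k" using d alt by linarith
  ultimately have "(?a + c * m I * (s * d)) mod m k = j" using j by (simp add: cong_def ac_simps)
  hence "addr k ((S ^^ (m I * (s * d))) y) = j" using addr_iterated_return[OF k y sum] by simp
  hence "addr k ((S ^^ (m I * (s * d) + n)) x) = j" by (simp add: y_def funpow_add)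
  thus ?thesis by blast
qed

lemma coprime_imp_minimal:
  assumes sum: "(\<Sum>j<m I. q j) = c * m I" and cop: "\<And>k. I \<le> k \<Longrightarrow> coprime c (m k div m I)"
  shows "minimal_homeomorphism X S"
proof -
  \<comment> \<open>Forward orbits are dense; this gives both surjectivity and minimality.\<close>
  have meets: "\<exists>n. (S ^^ n) x \<in> U" if x: "x \<in> topspace X" and U: "openin X U" "U \<noteq> {}" for x U
  proof -
    obtain u where u: "u \<in> U" using U by blast
    hence uX: "u \<in> topspace X" using openin_subset[OF U(1)] by blast
    obtain k where k: "I \<le> k" "1 \<le> k" "{y \<in> topspace X. addr k y = addr k u} \<subseteq> U"
      using fibre_in_open[OF U(1) u] by blast
    obtain n where "addr k ((S ^^ n) x) = addr k u"
      using coprime_imp_orbit_meets_fibre[OF k(1) sum cop[OF k(1)] x addr_less[OF k(2) uX]] by blast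
    thus ?thesis using k(3) funpow_S_in[OF x] by blast
  qed
  have "S ` topspace X = topspace X"
  proof (rule ccontr)
    assume ne: "S ` topspace X \<noteq> topspace X"
    have "compactin X (S ` topspace X)"
      using image_compactin[OF _ continuous_S] compact by (simp add: compact_space_def)
    hence "closedin X (S ` topspace X)"
      using compactin_imp_closedin[OF Hausdorff] by blast
    hence op: "openin X (topspace X - S ` topspace X)" by blast
    obtain x where x: "x \<in> topspace X" using nonempty by blast
    obtain n where "(S ^^ n) (S x) \<in> topspace X - S ` topspace X"
      using meets[OF S_in[OF x] op] ne S_in by blast
    moreover have "(S ^^ n) (S x) = S ((S ^^ n) x)" by (simp add: funpow_swap1)
    ultimately show False using funpow_S_in[OF x] by blast
  qed
  moreover have "inj_on S (topspace X)"
  proof (rule inj_onI)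
    fix x y assume xy: "x \<in> topspace X" "y \<in> topspace X" "S x = S y"
    have "move I (addr I x) = move I (addr I y)" using addr_S[OF order_refl] xy by metis
    hence "addr I x = addr I y"
      using cyclic_on_inj_on[OF cyclic_move] addr_less[OF I_pos] xy by (auto simp: inj_on_def)
    hence "p x = p y" using p_eq xy by simp
    thus "x = y" using funpow_T_inject[of x y "p x"] xy by (simp add: S_def)
  qed
  ultimately have hom: "homeomorphic_map X X S"
    by (intro continuous_imp_homeomorphic_map continuous_S compact Hausdorff)
  have "X closure_of full_orbit (topspace X) S x = topspace X" if x: "x \<in> topspace X" for x
  proof -
    have "y \<in> X closure_of full_orbit (topspace X) S x" if "y \<in> topspace X" for y
      unfolding in_closure_of
    proof (intro conjI allI impI that)
      fix U assume "y \<in> U \<and> openin X U"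
      then obtain n where "(S ^^ n) x \<in> U" using meets[OF x] by blast
      thus "\<exists>y. y \<in> full_orbit (topspace X) S x \<and> y \<in> U" unfolding full_orbit_def by blast
    qed
    thus ?thesis using closure_of_subset_topspace[of X] by blast
  qed
  thus ?thesis using hom by (simp add: minimal_homeomorphism_def)
qed

end

text \<open>
  The characterisation for arbitrary cyclic towers, with the arithmetic condition stated through the
  quotients of the periods.
\<close>

theorem (in tower_speedup) minimal_speedup_iff:
  assumes bdd: "bdd_above (p ` topspace X)"
  shows "minimal_homeomorphism X S \<longleftrightarrow>
    (\<exists>I\<ge>1. \<exists>q. (\<forall>x\<in>topspace X. p x = q (addr I x)) \<and>
       cyclic_on (displace (m I) q) {..<m I} \<and>
       (\<exists>c. (\<Sum>j<m I. q j) = c * m I \<and> (\<forall>k\<ge>I. coprime c (m k div m I))))"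
    (is "?L \<longleftrightarrow> ?R")
proof
  assume L: ?L
  hence cont: "continuous_map X X S"
    by (simp add: minimal_homeomorphism_def homeomorphic_imp_continuous_map)
  obtain I where I: "1 \<le> I"
    "\<And>x y. x \<in> topspace X \<Longrightarrow> y \<in> topspace X \<Longrightarrow> addr I x = addr I y \<Longrightarrow> p x = p y"
    using locally_constant_imp_addr_determined[OF continuous_speedup_imp_open_levels[OF cont bdd]] by metis
  define q where "q j = p (SOME x. x \<in> topspace X \<and> addr I x = j)" for j
  have q: "p x = q (addr I x)" if x: "x \<in> topspace X" for x
  proof -
    let ?y = "SOME y. y \<in> topspace X \<and> addr I y = addr I x"
    have "?y \<in> topspace X \<and> addr I ?y = addr I x" by (rule someI) (use x in simp)
    thus ?thesis unfolding q_def using I(2)[of x ?y] x by simp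
  qed
  interpret level_speedup X T m addr p S I q
    by unfold_locales (use I q in auto)
  note cyc = minimal_imp_cyclic[OF L]
  have base: "cyclic_on (displace (m I) q) {..<m I}"
    using cyc[OF order_refl] cyclic_cong[of "{..<m I}" "move I" "displace (m I) q"] move_cong_base by simp
  interpret cyclic_speedup X T m addr p S I q
    by unfold_locales (rule base)
  obtain c where c: "(\<Sum>j<m I. q j) = c * m I"
    using period_dvd_sum by (metis dvdE mult.commute)
  show ?R
    using I(1) q base c cyclic_imp_coprime[OF _ c cyc] by blast
next
  assume ?R
  then obtain I q c where *: "1 \<le> I" "\<And>x. x \<in> topspace X \<Longrightarrow> p x = q (addr I x)"
    "cyclic_on (displace (m I) q) {..<m I}" "(\<Sum>j<m I. q j) = c * m I"
    "\<And>k. I \<le> k \<Longrightarrow> coprime c (m k div m I)" by blast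
  interpret cyclic_speedup X T m addr p S I q
    by unfold_locales (use * in auto)
  show ?L using coprime_imp_minimal * by blast
qed

section \<open>The odometer as a cyclic tower\<close>

lemma compact_odometer_space: "compact_space (odometer_space \<alpha>)"
  unfolding odometer_space_def compact_space_product_topology
  by (simp add: compact_space_discrete_topology)

lemma funpow_image:
  fixes f :: "'a \<Rightarrow> 'a"
  shows "((`) f ^^ n) B = (f ^^ n) ` B"
  by (induction n) (auto simp: image_comp)

lemma odometer_period_Suc: "odometer_period \<alpha> (Suc k) = odometer_period \<alpha> k * \<alpha> (Suc k)"
  by (simp add: odometer_period_def)

text \<open>
  The quotient of the periods is the product of the \<open>\<alpha> i\<close> with \<open>I < i \<le> k\<close>.
\<close>

lemma coprime_period_quotient_iff:
  assumes pos: "odometer_period \<alpha> I > 0"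
  shows "(\<forall>k\<ge>I. coprime c (odometer_period \<alpha> k div odometer_period \<alpha> I)) \<longleftrightarrow> (\<forall>k>I. coprime c (\<alpha> k))"
proof -
  have quot: "odometer_period \<alpha> k div odometer_period \<alpha> I = (\<Prod>i\<in>{I<..k}. \<alpha> i)" if "I \<le> k" for k
  proof -
    have "{1..k} = {1..I} \<union> {I<..k}" "{1..I} \<inter> {I<..k} = {}" using that by auto
    hence "odometer_period \<alpha> k = odometer_period \<alpha> I * (\<Prod>i\<in>{I<..k}. \<alpha> i)"
      unfolding odometer_period_def by (metis prod.union_disjoint finite_atLeastAtMost finite_greaterThanAtMost)
    thus ?thesis using pos by simp
  qed
  show ?thesis
  proof (intro iffI allI impI)
    fix k assume "\<forall>k\<ge>I. coprime c (odometer_period \<alpha> k div odometer_period \<alpha> I)" and k: "I < k"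
    hence "coprime c (\<Prod>i\<in>{I<..k}. \<alpha> i)" using quot[of k] by (metis less_imp_le)
    moreover have "\<alpha> k dvd (\<Prod>i\<in>{I<..k}. \<alpha> i)" using k by (intro dvd_prodI) auto
    ultimately show "coprime c (\<alpha> k)" by (meson coprime_divisors dvd_refl)
  next
    fix k assume "\<forall>k>I. coprime c (\<alpha> k)" and k: "I \<le> k"
    thus "coprime c (odometer_period \<alpha> k div odometer_period \<alpha> I)"
      unfolding quot[OF k] by (intro prod_coprime_right) simp
  qed
qed

text \<open>
  The partitions need not be the canonical ones into cylinder sets, so addresses are defined by
  membership in the pieces and not by the digits of a point.
\<close>

locale odometer_tower =
  fixes \<alpha> :: "nat \<Rightarrow> nat" and A :: "nat \<Rightarrow> (nat \<Rightarrow> nat) set"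
  assumes radix_ge_2: "\<forall>i\<ge>1. \<alpha> i \<ge> 2"
    and associated: "associated_partitions \<alpha> A"
begin

abbreviation "X \<equiv> odometer_space \<alpha>"
abbreviation "T \<equiv> odometer_map \<alpha>"
abbreviation "m \<equiv> odometer_period \<alpha>"

abbreviation piece :: "nat \<Rightarrow> nat \<Rightarrow> (nat \<Rightarrow> nat) set" where
  "piece k j \<equiv> (T ^^ j) ` A k"

definition addr :: "nat \<Rightarrow> (nat \<Rightarrow> nat) \<Rightarrow> nat" where
  "addr k x = (THE j. j < m k \<and> x \<in> piece k j)"

lemma period_gt_0: "m k > 0"
  unfolding odometer_period_def
proof (intro prod_pos)
  fix i assume "i \<in> {1..k}"
  hence "\<alpha> i \<ge> 2" using radix_ge_2 by simp
  thus "0 < \<alpha> i" by simp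
qed

lemma partition_eq_image: "odometer_partition \<alpha> A k = piece k ` {..<m k}"
  unfolding odometer_partition_def by auto

lemma partition:
  assumes "1 \<le> k"
  shows "partition_on (topspace X) (odometer_partition \<alpha> A k)"
    and "card (odometer_partition \<alpha> A k) = m k"
    and "C \<in> odometer_partition \<alpha> A k \<Longrightarrow> openin X C"
    and "piece k (m k) = A k"
    and "i < m k \<Longrightarrow> j < m (Suc k) \<Longrightarrow> piece (Suc k) j \<subseteq> piece k i \<longleftrightarrow> j mod m k = i mod m k"
proof -
  note * = conjunct1[OF associated[unfolded associated_partitions_def], THEN spec, THEN mp, OF assms]
  show "partition_on (topspace X) (odometer_partition \<alpha> A k)"
    and "card (odometer_partition \<alpha> A k) = m k" and "piece k (m k) = A k"
    using * by simp_all
  show "openin X C" if "C \<in> odometer_partition \<alpha> A k"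
    using * that by (elim conjE) simp
  show "piece (Suc k) j \<subseteq> piece k i \<longleftrightarrow> j mod m k = i mod m k" if "i < m k" "j < m (Suc k)"
    using * that by (elim conjE) simp
qed

lemma inj_on_piece:
  assumes "1 \<le> k"
  shows "inj_on (piece k) {..<m k}"
  using partition(2)[OF assms] unfolding partition_eq_image by (intro eq_card_imp_inj_on) simp_all

text \<open>
  Since \<open>T\<close> to the power \<open>m k\<close> maps \<open>A k\<close> onto itself, pieces may be indexed by all naturals.
\<close>

lemma piece_mod:
  assumes "1 \<le> k"
  shows "piece k n = piece k (n mod m k)"
  using funpow_mod_eq[where f = "(`) T" and n = "m k" and x = "A k" and m = n] partition(4)[OF assms]
  by (simp add: funpow_image)

lemma image_funpow_piece: "(T ^^ n) ` piece k j = piece k (j + n)"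
  unfolding image_comp funpow_add[symmetric] add.commute[of n] ..

lemma piece_subset: "1 \<le> k \<Longrightarrow> piece k j \<subseteq> topspace X"
  using partition(1)[of k] piece_mod[of k j] period_gt_0[of k]
  unfolding partition_eq_image partition_on_def by fastforce

lemma mem_piece_iff:
  assumes "1 \<le> k" "x \<in> topspace X" "j < m k"
  shows "x \<in> piece k j \<longleftrightarrow> addr k x = j"
proof -
  have unique: "i = i'" if "i < m k" "i' < m k" "x \<in> piece k i" "x \<in> piece k i'" for i i'
  proof -
    have "piece k i = piece k i'"
      using partition(1)[OF assms(1)] that
      unfolding partition_eq_image partition_on_def disjoint_def by blast
    thus ?thesis using inj_on_piece[OF assms(1)] that by (auto simp: inj_on_def)
  qed
  have "x \<in> \<Union>(odometer_partition \<alpha> A k)"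
    using partition_onD1[OF partition(1)[OF assms(1)]] assms(2) by simp
  then obtain i where i: "i < m k" "x \<in> piece k i"
    unfolding partition_eq_image by blast
  have "addr k x = i"
    unfolding addr_def by (rule the_equality) (use i unique in auto)
  thus ?thesis using i unique assms(3) by metis
qed

lemma addr_spec:
  assumes "1 \<le> k" "x \<in> topspace X"
  shows "addr k x < m k" and "x \<in> piece k (addr k x)"
proof -
  have "x \<in> \<Union>(odometer_partition \<alpha> A k)"
    using partition_onD1[OF partition(1)[OF assms(1)]] assms(2) by simp
  then obtain i where i: "i < m k" "x \<in> piece k i"
    unfolding partition_eq_image by blast
  thus "addr k x < m k" "x \<in> piece k (addr k x)"
    using mem_piece_iff[OF assms i(1)] by simp_all
qed

lemma addrI: "1 \<le> k \<Longrightarrow> x \<in> piece k j \<Longrightarrow> addr k x = j mod m k"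
  using mem_piece_iff[of k x "j mod m k"] piece_mod[of k j] piece_subset[of k j] period_gt_0[of k] by auto

sublocale cyclic_tower X T m addr
proof
  show "compact_space X" by (rule compact_odometer_space)
  show "topspace X \<noteq> {}"
  proof -
    have "piece 1 0 \<noteq> {}"
      using partition_onD3[OF partition(1)[of 1]] period_gt_0[of 1] unfolding partition_eq_image by force
    thus ?thesis using piece_subset[of 1 0] by auto
  qed
  fix k :: nat assume k: "1 \<le> k"
  show "m k dvd m (Suc k)" by (simp add: odometer_period_Suc)
  have "m k * 1 < m k * \<alpha> (Suc k)"
    using radix_ge_2[rule_format, of "Suc k"] period_gt_0[of k] by (intro mult_strict_left_mono) simp_all
  thus "m k < m (Suc k)" by (simp add: odometer_period_Suc)
  show "openin X {x \<in> topspace X. addr k x = j}" for j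
  proof (cases "j < m k")
    case True
    hence "{x \<in> topspace X. addr k x = j} = piece k j"
      using mem_piece_iff[OF k] piece_subset[OF k, of j] by auto
    thus ?thesis using partition(3)[OF k, of "piece k j"] True unfolding partition_eq_image by auto
  next
    case False
    hence "{x \<in> topspace X. addr k x = j} = {}" using addr_spec(1)[OF k] by auto
    thus ?thesis by (simp only: openin_empty)
  qed
next
  fix x assume x: "x \<in> topspace X"
  have Tx: "T x \<in> piece k (Suc (addr k x))" if "1 \<le> k" for k
    using imageI[OF addr_spec(2)[OF that x], of T] by (simp add: image_comp)
  show "T x \<in> topspace X" by (rule subsetD[OF piece_subset Tx, of 1]) simp_all
  fix k :: nat assume k: "1 \<le> k"
  show "addr k x < m k" using addr_spec(1)[OF k x] .
  show "addr k (T x) = Suc (addr k x) mod m k" using addrI[OF k Tx[OF k]] .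
  have k': "1 \<le> Suc k" by simp
  let ?j = "addr (Suc k) x"
  have "piece (Suc k) ?j \<subseteq> piece k (?j mod m k)"
    using partition(5)[OF k, of "?j mod m k" ?j] addr_spec(1)[OF k' x] period_gt_0[of k] by simp
  hence "x \<in> piece k (?j mod m k)" using addr_spec(2)[OF k' x] by blast
  thus "?j mod m k = addr k x" using addrI[OF k] by simp
next
  fix x y assume xy: "x \<in> topspace X" "y \<in> topspace X" and eq: "\<And>k. 1 \<le> k \<Longrightarrow> addr k x = addr k y"
  show "x = y"
  proof (rule ccontr)
    assume ne: "x \<noteq> y"
    obtain k C where k: "1 \<le> k" and C: "C \<in> odometer_partition \<alpha> A k" "x \<in> C" "y \<notin> C"
      using conjunct1[OF conjunct2[OF associated[unfolded associated_partitions_def]],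
          THEN bspec, OF xy(1), THEN bspec, OF xy(2), THEN mp, OF ne] by blast
    then obtain j where j: "j < m k" "C = piece k j" unfolding partition_eq_image by blast
    show False using C(2,3) unfolding j(2) using mem_piece_iff[OF k _ j(1)] xy eq[OF k] by simp
  qed
qed

lemma constant_on_pieces_iff:
  assumes I: "1 \<le> I" and pos: "\<forall>x\<in>topspace X. p x > 0"
  shows "(\<forall>j<m I. q j > 0 \<and> (\<forall>x\<in>piece I j. p x = q j)) \<longleftrightarrow> (\<forall>x\<in>topspace X. p x = q (addr I x))"
proof
  assume L: "\<forall>j<m I. q j > 0 \<and> (\<forall>x\<in>piece I j. p x = q j)"
  show "\<forall>x\<in>topspace X. p x = q (addr I x)"
    using L addr_spec[OF I] by blast
next
  assume R: "\<forall>x\<in>topspace X. p x = q (addr I x)"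
  show "\<forall>j<m I. q j > 0 \<and> (\<forall>x\<in>piece I j. p x = q j)"
  proof (intro allI impI conjI ballI)
    fix j assume j: "j < m I"
    obtain x where x: "x \<in> topspace X" "addr I x = j" using addr_surj[OF I j] by blast
    thus "q j > 0" using R pos by metis
    fix y assume y: "y \<in> piece I j"
    hence "y \<in> topspace X" using piece_subset[OF I] by blast
    thus "p y = q j" using R addrI[OF I y] j by simp
  qed
qed

text \<open>
  On each piece \<open>S\<close> is a single power of \<open>T\<close>, so it maps pieces onto pieces, and \<open>piece I\<close>
  carries \<open>displace\<close> over to this action on sets.
\<close>

lemma cyclically_permuted_iff:
  assumes I: "1 \<le> I" and const: "\<forall>j<m I. \<forall>x\<in>piece I j. p x = q j"
    and S: "S = (\<lambda>x. (T ^^ p x) x)"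
  shows "cyclically_permuted S (odometer_partition \<alpha> A I) \<longleftrightarrow> cyclic_on (displace (m I) q) {..<m I}"
proof -
  have img: "S ` piece I j = piece I (displace (m I) q j)" if "j < m I" for j
  proof -
    have "S ` piece I j = (T ^^ q j) ` piece I j"
      unfolding S using const[rule_format, OF that] by (intro image_cong refl) (simp only:)
    thus ?thesis using piece_mod[OF I, of "j + q j"] unfolding image_funpow_piece displace_def by simp
  qed
  have maps: "displace (m I) q ` {..<m I} \<subseteq> {..<m I}"
    using period_gt_0[of I] by (auto simp: displace_def)
  have "\<forall>C\<in>odometer_partition \<alpha> A I. S ` C \<in> odometer_partition \<alpha> A I"
    unfolding partition_eq_image using img maps by auto
  moreover have "cyclic_on ((`) S) (piece I ` {..<m I}) \<longleftrightarrow> cyclic_on (displace (m I) q) {..<m I}"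
    by (rule cyclic_on_image_iff[OF inj_on_piece[OF I] maps]) (use img in simp)
  ultimately show ?thesis
    unfolding cyclically_permuted_def partition_eq_image by simp
qed

text \<open>
  The integer multiplier is a natural number, as \<open>N\<close> and the period are nonnegative and the period
  is not zero.
\<close>

lemma multiplier_iff:
  assumes I: "1 \<le> I"
  shows "(\<exists>c::nat. N = c * m I \<and> (\<forall>k\<ge>I. coprime c (m k div m I))) \<longleftrightarrow>
    (\<exists>c::int. int N = c * int (m I) \<and> (\<forall>k>I. gcd c (int (\<alpha> k)) = 1))"
    (is "?L \<longleftrightarrow> ?R")
proof
  assume ?L
  then obtain c where c: "N = c * m I" "\<forall>k>I. coprime c (\<alpha> k)"
    using coprime_period_quotient_iff[OF period_gt_0] by blast
  hence "int N = int c * int (m I) \<and> (\<forall>k>I. gcd (int c) (int (\<alpha> k)) = 1)"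
    by (simp add: coprime_iff_gcd_eq_1)
  thus ?R by blast
next
  assume ?R
  then obtain c where c: "int N = c * int (m I)" "\<forall>k>I. gcd c (int (\<alpha> k)) = 1" by blast
  have "0 \<le> c * int (m I)" unfolding c(1)[symmetric] by simp
  hence "0 \<le> c" using period_gt_0[of I] by (simp add: zero_le_mult_iff)
  then obtain d where d: "c = int d" using nonneg_int_cases by blast
  have "int N = int (d * m I)" using c(1) d by simp
  hence "N = d * m I" by (simp only: of_nat_eq_iff)
  moreover have "\<forall>k>I. coprime d (\<alpha> k)" using c(2) d by (simp add: coprime_iff_gcd_eq_1)
  ultimately show ?L using coprime_period_quotient_iff[OF period_gt_0] by blast
qed

end

text \<open>
  A minimal homeomorphism \<open>S\<close> is a bounded speedup with exponent \<open>p\<close>; the rest translates addresses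
  back into pieces.
\<close>

theorem theorem3p11:
  fixes \<alpha> :: "nat \<Rightarrow> nat"
    and A :: "nat \<Rightarrow> (nat \<Rightarrow> nat) set"
    and p :: "(nat \<Rightarrow> nat) \<Rightarrow> nat"
    and T S :: "(nat \<Rightarrow> nat) \<Rightarrow> (nat \<Rightarrow> nat)"
    and X :: "(nat \<Rightarrow> nat) topology"
    and m :: "nat \<Rightarrow> nat"
  assumes "\<forall>i\<ge>1. \<alpha> i \<ge> 2"
    and "X = odometer_space \<alpha>"
    and "T = odometer_map \<alpha>"
    and "m = odometer_period \<alpha>"
    and "associated_partitions \<alpha> A"
    and "\<forall>x\<in>topspace X. p x > 0"
    and "bdd_above (p ` topspace X)"
    and "S = (\<lambda>x. (T ^^ p x) x)"
  shows "(bounded_speedup X T S \<and> minimal_homeomorphism X S) \<longleftrightarrow>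
    (\<exists>I\<ge>1. \<exists>q :: nat \<Rightarrow> nat.
       (\<forall>j<m I. q j > 0 \<and> (\<forall>x\<in>(T ^^ j) ` A I. p x = q j)) \<and>
       cyclically_permuted S (odometer_partition \<alpha> A I) \<and>
       (\<exists>c::int. int (\<Sum>j<m I. q j) = c * int (m I) \<and>
          (\<forall>k>I. gcd c (int (\<alpha> k)) = 1)))"
proof -
  interpret odometer_tower \<alpha> A
    using assms by unfold_locales auto
  note defs = assms(2-4)
  interpret tower_speedup "odometer_space \<alpha>" "odometer_map \<alpha>" "odometer_period \<alpha>" addr p S
    by unfold_locales (simp add: assms(8) defs)
  have pos: "\<forall>x\<in>topspace (odometer_space \<alpha>). p x > 0" and
    bdd: "bdd_above (p ` topspace (odometer_space \<alpha>))"
    using assms(6,7) unfolding defs .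
  have "bounded_speedup X T S \<and> minimal_homeomorphism X S \<longleftrightarrow>
      minimal_homeomorphism (odometer_space \<alpha>) S"
    using pos bdd unfolding defs bounded_speedup_def minimal_homeomorphism_def by (auto simp: S_def)
  also have "\<dots> \<longleftrightarrow> (\<exists>I\<ge>1. \<exists>q. (\<forall>x\<in>topspace (odometer_space \<alpha>). p x = q (addr I x)) \<and>
       cyclic_on (displace (odometer_period \<alpha> I) q) {..<odometer_period \<alpha> I} \<and>
       (\<exists>c. (\<Sum>j<odometer_period \<alpha> I. q j) = c * odometer_period \<alpha> I \<and>
          (\<forall>k\<ge>I. coprime c (odometer_period \<alpha> k div odometer_period \<alpha> I))))"
    by (rule minimal_speedup_iff[OF bdd])
  also have "\<dots> \<longleftrightarrow> (\<exists>I\<ge>1. \<exists>q :: nat \<Rightarrow> nat.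
       (\<forall>j<m I. q j > 0 \<and> (\<forall>x\<in>(T ^^ j) ` A I. p x = q j)) \<and>
       cyclically_permuted S (odometer_partition \<alpha> A I) \<and>
       (\<exists>c::int. int (\<Sum>j<m I. q j) = c * int (m I) \<and>
          (\<forall>k>I. gcd c (int (\<alpha> k)) = 1)))"
    unfolding defs
  proof (intro ex_cong1 conj_cong refl)
    fix I :: nat and q assume I: "1 \<le> I"
    show const: "(\<forall>x\<in>topspace (odometer_space \<alpha>). p x = q (addr I x)) \<longleftrightarrow>
      (\<forall>j<odometer_period \<alpha> I. 0 < q j \<and> (\<forall>x\<in>(odometer_map \<alpha> ^^ j) ` A I. p x = q j))"
      using constant_on_pieces_iff[OF I pos] by blast
    assume "\<forall>j<odometer_period \<alpha> I. 0 < q j \<and> (\<forall>x\<in>(odometer_map \<alpha> ^^ j) ` A I. p x = q j)"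
    thus "cyclic_on (displace (odometer_period \<alpha> I) q) {..<odometer_period \<alpha> I} \<longleftrightarrow>
        cyclically_permuted S (odometer_partition \<alpha> A I)"
      using cyclically_permuted_iff[OF I _ S_def] by blast
    show "(\<exists>c. (\<Sum>j<odometer_period \<alpha> I. q j) = c * odometer_period \<alpha> I \<and>
          (\<forall>k\<ge>I. coprime c (odometer_period \<alpha> k div odometer_period \<alpha> I))) \<longleftrightarrow>
        (\<exists>c::int. int (\<Sum>j<odometer_period \<alpha> I. q j) = c * int (odometer_period \<alpha> I) \<and>
          (\<forall>k>I. gcd c (int (\<alpha> k)) = 1))"
      by (rule multiplier_iff[OF I])
  qed
  finally show ?thesis .
qed

end
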